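(* For any $\alpha\in(0,1/2)$ and any $H,A\in\mathbb N^+$, there exists an undercomplete $\alpha$-weakly revealing POMDP with $A$ actions, horizon $H$, and $S,O=\mathcal O(1)$, so that any algorithm requires at least $\Omega\left(\min\left\{\frac{1}{\alpha H},A^{H-1}\right\}\right)$ samples to learn a $(1/2)$-optimal policy with probability $1/6$ or higher.
   Context: Notation: $[n]=\{1,\dots,n\}$; $\Delta_X$ is the set of probability distributions on a finite set $X$; $\sigma_j(M)$ is the $j$-th largest singular value of $M$; $\mathcal O(\cdot)$ and $\Omega(\cdot)$ hide absolute constants. POMDP: a tuple $(\mathscr S,\mathscr A,\mathscr O;H,\mu_1,\mathbb T,\mathbb O;r)$ with finite sets of states, actions, observations of sizes $S,A,O$; horizon $H$; initial state distribution $\mu_1$; transition matrices $\mathbb T_{h,a}\in\mathbb R^{S\times S}$, where $\mathbb T_{h,a}(\cdot\mid s)$ is the distribution of the next state; emission matrices $\mathbb O_h\in\mathbb R^{O\times S}$, where $\mathbb O_h(\cdot\mid s)$ is the distribution of the observation; rewards $r_h:\mathscr O\to[0,1]$. In an episode $s_1\sim\mu_1$; at step $h$ the learner sees $o_h\sim\mathbb O_h(\cdot\mid s_h)$, receives $r_h(o_h)$, takes $a_h$, and $s_{h+1}\sim\mathbb T_{h,a_h}(\cdot\mid s_h)$; the episode ends after step $H$. States are never observed. A policy is $\pi=\{\pi_h\}_{h=1}^H$ with $\pi_h:(\mathscr O\times\mathscr A)^{h-1}\times\mathscr O\to\Delta_{\mathscr A}$; $V^\pi=\mathbb E_\pi[\sum_{h=1}^H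 r_h(o_h)]$, $V^\star=\sup_\pi V^\pi$; $\pi$ is $\epsilon$-optimal if $V^\pi\ge V^\star-\epsilon$. The POMDP is undercomplete if $S\le O$, and $\alpha$-weakly revealing if $\min_{h\in[H]}\sigma_S(\mathbb O_h)\ge\alpha$. An algorithm interacts with the unknown POMDP for some number of episodes (samples), choosing in each episode a policy based on past data and observing only the observations, its actions and rewards, and finally outputs a policy. *)

theory Defs
  imports
    "HOL-Probability.Probability"
    "HOL-Computational_Algebra.Polynomial"
    "Jordan_Normal_Form.Char_Poly"
begin

text \<open>
  The singular values of \<open>M\<close>, with multiplicity and in decreasing order: the square roots of the
  eigenvalues of the positive semidefinite matrix \<open>M\<^sup>T M\<close>. There are as many of
  them as \<open>M\<close> has columns.
\<close>

definition singular_values :: "real mat \<Rightarrow> real list" where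
  "singular_values M =
     rev (sorted_list_of_multiset (image_mset sqrt (proots (char_poly (transpose_mat M * M)))))"

text \<open>
  The \<open>j\<close>-th largest singular value, \<open>j\<close> counting from 1; meaningful for
  \<open>1 \<le> j \<le> dim_col M\<close>.
\<close>

definition singular_value :: "nat \<Rightarrow> real mat \<Rightarrow> real" where
  "singular_value j M = singular_values M ! (j - 1)"

text \<open>
  States, actions and observations are the numbers below \<open>n_states\<close>, \<open>n_actions\<close> and \<open>n_obs\<close>;
  steps are numbered from \<open>1\<close> to \<open>horizon\<close>. \<open>trans M h a s\<close> is the law of the next state and
  \<open>emit M h s\<close> the law of the observation.
\<close>

record pomdp =
  n_states :: nat
  n_actions :: nat
  n_obs :: nat
  horizon :: nat
  init :: "nat pmf"
  trans :: "nat \<Rightarrow> nat \<Rightarrow> nat \<Rightarrow> nat pmf"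
  emit :: "nat \<Rightarrow> nat \<Rightarrow> nat pmf"
  reward :: "nat \<Rightarrow> nat \<Rightarrow> real"

definition is_pomdp :: "pomdp \<Rightarrow> bool" where
  "is_pomdp M \<longleftrightarrow>
     set_pmf (init M) \<subseteq> {..<n_states M} \<and>
     (\<forall>h\<in>{1..horizon M}.
        (\<forall>s<n_states M. \<forall>a<n_actions M. set_pmf (trans M h a s) \<subseteq> {..<n_states M}) \<and>
        (\<forall>s<n_states M. set_pmf (emit M h s) \<subseteq> {..<n_obs M}) \<and>
        (\<forall>x<n_obs M. 0 \<le> reward M h x \<and> reward M h x \<le> 1))"

definition undercomplete :: "pomdp \<Rightarrow> bool" where
  "undercomplete M \<longleftrightarrow> n_states M \<le> n_obs M"

definition emission_matrix :: "pomdp \<Rightarrow> nat \<Rightarrow> real mat" where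
  "emission_matrix M h = mat (n_obs M) (n_states M) (\<lambda>(x, s). pmf (emit M h s) x)"

definition weakly_revealing :: "real \<Rightarrow> pomdp \<Rightarrow> bool" where
  "weakly_revealing \<alpha> M \<longleftrightarrow>
     Min ((\<lambda>h. singular_value (n_states M) (emission_matrix M h)) ` {1..horizon M}) \<ge> \<alpha>"

text \<open>
  \<open>\<pi> h \<tau> x\<close> is the law of the action at step \<open>h\<close>, given the list \<open>\<tau>\<close> of the \<open>h - 1\<close> earlier
  observation-action pairs (oldest first) and the current observation \<open>x\<close>. Only the values at
  arguments in \<open>valid_history\<close> matter.
\<close>

type_synonym history = "(nat \<times> nat) list"
type_synonym policy = "nat \<Rightarrow> history \<Rightarrow> nat \<Rightarrow> nat pmf"

definition valid_history :: "nat \<Rightarrow> nat \<Rightarrow> nat \<Rightarrow> nat \<Rightarrow> history \<Rightarrow> nat \<Rightarrow> bool" where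
  "valid_history nO nA H h \<tau> x \<longleftrightarrow>
     h \<in> {1..H} \<and> length \<tau> = h - 1 \<and> set \<tau> \<subseteq> {..<nO} \<times> {..<nA} \<and> x < nO"

definition is_policy :: "nat \<Rightarrow> nat \<Rightarrow> nat \<Rightarrow> policy \<Rightarrow> bool" where
  "is_policy nO nA H \<pi> \<longleftrightarrow>
     (\<forall>h \<tau> x. valid_history nO nA H h \<tau> x \<longrightarrow> set_pmf (\<pi> h \<tau> x) \<subseteq> {..<nA})"

text \<open>
  The joint law of the history of the first \<open>h\<close> steps and the state \<open>s\<^bsub>h+1\<^esub>\<close>. For \<open>h = horizon M\<close>
  that state is drawn too, but it is discarded in \<open>episode\<close>.
\<close>

primrec trajectory :: "pomdp \<Rightarrow> policy \<Rightarrow> nat \<Rightarrow> (history \<times> nat) pmf" where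
  "trajectory M \<pi> 0 = map_pmf (\<lambda>s. ([], s)) (init M)"
| "trajectory M \<pi> (Suc h) =
     bind_pmf (trajectory M \<pi> h) (\<lambda>(\<tau>, s).
     bind_pmf (emit M (Suc h) s) (\<lambda>x.
     bind_pmf (\<pi> (Suc h) \<tau> x) (\<lambda>a.
     map_pmf (\<lambda>s'. (\<tau> @ [(x, a)], s')) (trans M (Suc h) a s))))"

definition episode :: "pomdp \<Rightarrow> policy \<Rightarrow> history pmf" where
  "episode M \<pi> = map_pmf fst (trajectory M \<pi> (horizon M))"

definition policy_value :: "pomdp \<Rightarrow> policy \<Rightarrow> real" where
  "policy_value M \<pi> =
     measure_pmf.expectation (episode M \<pi>)
       (\<lambda>\<tau>. \<Sum>h=1..horizon M. reward M h (fst (\<tau> ! (h - 1))))"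

definition optimal_value :: "pomdp \<Rightarrow> real" where
  "optimal_value M = (SUP \<pi>\<in>{\<pi>. is_policy (n_obs M) (n_actions M) (horizon M) \<pi>}. policy_value M \<pi>)"

definition eps_optimal :: "pomdp \<Rightarrow> real \<Rightarrow> policy \<Rightarrow> bool" where
  "eps_optimal M \<epsilon> \<pi> \<longleftrightarrow> policy_value M \<pi> \<ge> optimal_value M - \<epsilon>"

type_synonym episode_data = "(nat \<times> nat \<times> real) list"

definition observed :: "pomdp \<Rightarrow> history \<Rightarrow> episode_data" where
  "observed M \<tau> = map (\<lambda>(h, x, a). (x, a, reward M h x)) (List.enumerate 1 \<tau>)"

text \<open>
  The internal randomness of an algorithm is a seed \<open>\<omega>\<close>, drawn once from an arbitrary probability
  space on the reals and available throughout. \<open>explore L \<omega> D\<close> is the policy for the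
  next episode after the data \<open>D\<close> (one entry per past episode), \<open>final_policy L \<omega> D\<close> the policy returned
  at the end. As \<open>explore\<close> sees \<open>\<omega>\<close> and \<open>D\<close>, the choice may also depend on the policies used before.
\<close>

record learner =
  seed :: "real measure"
  explore :: "real \<Rightarrow> episode_data list \<Rightarrow> policy"
  final_policy :: "real \<Rightarrow> episode_data list \<Rightarrow> policy"

definition random_policy :: "nat \<Rightarrow> nat \<Rightarrow> nat \<Rightarrow> real measure \<Rightarrow> (real \<Rightarrow> policy) \<Rightarrow> bool" where
  "random_policy nO nA H W f \<longleftrightarrow>
     (\<forall>\<omega>\<in>space W. is_policy nO nA H (f \<omega>)) \<and>
     (\<forall>h \<tau> x a. valid_history nO nA H h \<tau> x \<longrightarrow>
        (\<lambda>\<omega>. pmf (f \<omega> h \<tau> x) a) \<in> borel_measurable W)"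

definition is_learner :: "nat \<Rightarrow> nat \<Rightarrow> nat \<Rightarrow> learner \<Rightarrow> bool" where
  "is_learner nO nA H L \<longleftrightarrow>
     prob_space (seed L) \<and>
     (\<forall>D. random_policy nO nA H (seed L) (\<lambda>\<omega>. explore L \<omega> D) \<and>
          random_policy nO nA H (seed L) (\<lambda>\<omega>. final_policy L \<omega> D))"

primrec interaction :: "pomdp \<Rightarrow> learner \<Rightarrow> real \<Rightarrow> nat \<Rightarrow> episode_data list pmf" where
  "interaction M L \<omega> 0 = return_pmf []"
| "interaction M L \<omega> (Suc k) =
     bind_pmf (interaction M L \<omega> k) (\<lambda>D.
     map_pmf (\<lambda>\<tau>. D @ [observed M \<tau>]) (episode M (explore L \<omega> D)))"

definition success_prob :: "pomdp \<Rightarrow> learner \<Rightarrow> nat \<Rightarrow> real \<Rightarrow> real" where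
  "success_prob M L K \<epsilon> =
     (\<integral>\<omega>. measure_pmf.prob (interaction M L \<omega> K) {D. eps_optimal M \<epsilon> (final_policy L \<omega> D)} \<partial>seed L)"

end

theory Submission
  imports Defs
begin

text \<open>
  The hard instances are combination locks: a lock is opened only by playing a secret sequence of
  \<open>H - 1\<close> actions, and before the last step the observation says whether the sequence is still
  correct only with probability \<open>\<alpha>\<close> (otherwise it is a dummy). Compare a lock with the null process
  that always shows the dummy and ends in failure. On the histories that miss the secret the law
  under the lock is at least \<open>(1 - \<alpha>)\<^bsup>H-1\<^esup>\<close> times the null law, so over \<open>K\<close> episodes the two differ
  by at most \<open>\<alpha> H K\<close> plus the null probability that the secret was ever played. Summed over all
  secrets, the latter is at most \<open>K\<close>, and a fixed policy is good for at most four of them.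
\<close>

section \<open>Sequentially generated lists\<close>

text \<open>An episode is a chain of observation-action pairs and a run of the learner is a chain of
  episodes. One likelihood comparison for \<open>chain\<close> therefore serves both levels.\<close>

primrec chain :: "('a list \<Rightarrow> 'a pmf) \<Rightarrow> nat \<Rightarrow> 'a list pmf" where
  "chain f 0 = return_pmf []"
| "chain f (Suc n) = bind_pmf (chain f n) (\<lambda>xs. map_pmf (\<lambda>x. xs @ [x]) (f xs))"

lemma length_chain: "xs \<in> set_pmf (chain f n) \<Longrightarrow> length xs = n"
  by (induction n arbitrary: xs) auto

lemma nth_chain:
  "xs \<in> set_pmf (chain f n) \<Longrightarrow> i < n \<Longrightarrow> xs ! i \<in> set_pmf (f (take i xs))"
proof (induction n arbitrary: xs)
  case (Suc n)
  then obtain ys y where ys: "ys \<in> set_pmf (chain f n)" "y \<in> set_pmf (f ys)" "xs = ys @ [y]"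
    by auto
  then show ?case
    using Suc length_chain[OF ys(1)] by (cases "i = n") (auto simp: nth_append)
qed simp

lemma pmf_bind_snoc:
  "pmf (bind_pmf p (\<lambda>xs. map_pmf (\<lambda>x. xs @ [x]) (f xs))) (ys @ [y]) = pmf p ys * pmf (f ys) y"
proof -
  have "pmf (map_pmf (\<lambda>x. xs @ [x]) (f xs)) (ys @ [y]) = pmf (f ys) y * indicator {ys} xs" for xs
  proof (cases "xs = ys")
    case True
    then show ?thesis
      using pmf_map_inj'[of "\<lambda>x. ys @ [x]" "f ys" y] by (simp add: inj_def)
  next
    case False
    then show ?thesis
      by (auto simp: pmf_eq_0_set_pmf)
  qed
  then show ?thesis
    by (simp add: pmf_bind measure_pmf_single)
qed

text \<open>Likelihoods of lists are products of conditional likelihoods, so one-step ratios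
  multiply. Only prefixes of the given \<open>xs\<close> are compared, which lets the bounds use a
  property of \<open>xs\<close> such as having missed the secret.\<close>

lemma pmf_chain_mono:
  assumes "length xs = n" and "\<And>i. i < n \<Longrightarrow> 0 \<le> c i"
    and "\<And>i. i < n \<Longrightarrow> c i * pmf (g (take i xs)) (xs ! i) \<le> pmf (f (take i xs)) (xs ! i)"
  shows "(\<Prod>i<n. c i) * pmf (chain g n) xs \<le> pmf (chain f n) xs"
  using assms
proof (induction n arbitrary: xs)
  case (Suc n)
  then obtain ys y where xs: "xs = ys @ [y]" "length ys = n"
    by (metis length_Suc_conv_rev)
  have "(\<Prod>i<n. c i) * pmf (chain g n) ys \<le> pmf (chain f n) ys"
    using Suc.prems(2,3) xs by (intro Suc.IH) (force simp: nth_append less_Suc_eq)+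
  moreover have "c n * pmf (g ys) y \<le> pmf (f ys) y"
    using Suc.prems(3)[of n] xs by (simp add: nth_append)
  ultimately have "((\<Prod>i<n. c i) * pmf (chain g n) ys) * (c n * pmf (g ys) y)
      \<le> pmf (chain f n) ys * pmf (f ys) y"
    using Suc.prems(2) by (intro mult_mono) (auto intro!: mult_nonneg_nonneg prod_nonneg)
  then show ?case
    by (simp add: xs pmf_bind_snoc mult_ac)
qed simp

section \<open>Probabilities under two laws\<close>

lemma prob_mono_pmf:
  assumes "0 \<le> c" and "\<And>x. x \<in> G \<Longrightarrow> c * pmf q x \<le> pmf p x"
  shows "c * measure_pmf.prob q G \<le> measure_pmf.prob p G"
proof -
  have "ennreal c * emeasure (measure_pmf q) G = (\<integral>\<^sup>+x. ennreal c * pmf q x \<partial>count_space G)"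
    by (simp add: nn_integral_cmult nn_integral_pmf)
  also have "\<dots> \<le> (\<integral>\<^sup>+x. pmf p x \<partial>count_space G)"
    using assms by (intro nn_integral_mono) (simp add: ennreal_mult'[symmetric] ennreal_leI)
  finally show ?thesis
    using assms by (simp add: nn_integral_pmf measure_pmf.emeasure_eq_measure flip: ennreal_mult')
qed

text \<open>One-sided change of measure, with a lower bound on \<open>p\<close> that holds on
  \<open>G\<close> only. It is applied to \<open>G - F\<close>, whose \<open>q\<close>-mass is at
  least \<open>1 - q F - q (- G)\<close>; the mass of \<open>p\<close> found there is lost to
  \<open>F\<close>.\<close>

lemma prob_le_of_pmf_ge:
  assumes "0 \<le> c" "c \<le> 1" and "\<And>x. x \<in> G \<Longrightarrow> c * pmf q x \<le> pmf p x"
  shows "measure_pmf.prob p F \<le> measure_pmf.prob q F + (1 - c) + measure_pmf.prob q (- G)"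
proof -
  have "F \<union> - G \<union> (G - F) = UNIV"
    by auto
  then have "1 = measure_pmf.prob q (F \<union> - G \<union> (G - F))"
    by simp
  also have "\<dots> \<le> measure_pmf.prob q F + measure_pmf.prob q (- G) + measure_pmf.prob q (G - F)"
    by (intro order.trans[OF measure_Un_le] add_mono order.refl) auto
  finally have "1 - (measure_pmf.prob q F + measure_pmf.prob q (- G)) \<le> measure_pmf.prob q (G - F)"
    by simp
  then have "c * (1 - (measure_pmf.prob q F + measure_pmf.prob q (- G)))
      \<le> c * measure_pmf.prob q (G - F)"
    using assms(1) by (rule mult_left_mono)
  also have "\<dots> \<le> measure_pmf.prob p (G - F)"
    using assms by (intro prob_mono_pmf) auto
  also have "\<dots> \<le> measure_pmf.prob p (- F)"
    by (intro measure_pmf.finite_measure_mono) auto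
  also have "\<dots> = 1 - measure_pmf.prob p F"
    using measure_pmf.prob_compl[of F p] by (simp add: Compl_eq_Diff_UNIV)
  finally have "measure_pmf.prob p F
      \<le> 1 - c + c * (measure_pmf.prob q F + measure_pmf.prob q (- G))"
    by (simp add: algebra_simps)
  moreover have "c * (measure_pmf.prob q F + measure_pmf.prob q (- G))
      \<le> measure_pmf.prob q F + measure_pmf.prob q (- G)"
    using assms by (intro mult_left_le_one_le) auto
  ultimately show ?thesis
    by simp
qed

text \<open>Double counting: the sum is the expected number of \<open>t\<close> with
  \<open>R t x\<close>.\<close>

lemma sum_prob_le_card:
  assumes "finite T" and "\<And>x. x \<in> set_pmf p \<Longrightarrow> card {t \<in> T. R t x} \<le> n"
  shows "(\<Sum>t\<in>T. measure_pmf.prob p {x. R t x}) \<le> real n"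
proof -
  have "(\<Sum>t\<in>T. measure_pmf.prob p {x. R t x})
      = (\<Sum>t\<in>T. measure_pmf.expectation p (indicator {x. R t x}))"
    by simp
  also have "\<dots> = measure_pmf.expectation p (\<lambda>x. \<Sum>t\<in>T. indicator {x. R t x} x)"
    by (subst Bochner_Integration.integral_sum)
       (auto intro!: measure_pmf.integrable_const_bound[where B = 1])
  also have "(\<lambda>x. \<Sum>t\<in>T. indicator {x. R t x} x) = (\<lambda>x. real (card {t \<in> T. R t x}))"
    using assms(1) by (auto simp: indicator_def sum.If_cases Int_def intro!: ext)
  also have "measure_pmf.expectation p \<dots> \<le> real n"
    using assms(2) by (intro measure_pmf.integral_le_const measure_pmf.integrable_const_bound[where B = n])
       (auto simp: AE_measure_pmf_iff)
  finally show ?thesis .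
qed

section \<open>Singular values of the erasure channel\<close>

lemma sorted_list_of_multiset_pair:
  "x \<le> y \<Longrightarrow> sorted_list_of_multiset {#y, x#} = [x, y]"
  by (simp add: add_mset_commute)

lemma det_mat2:
  fixes A :: "'a :: comm_ring_1 mat"
  assumes "A \<in> carrier_mat 2 2"
  shows "Determinant.det A = A $$ (0, 0) * A $$ (1, 1) - A $$ (0, 1) * A $$ (1, 0)"
proof -
  have "Determinant.det (mat_delete A i 0) = A $$ (1 - i, 1)" if "i < 2" for i
    using assms that
    by (subst det_single) (auto simp: mat_delete_def less_2_cases_iff)
  then show ?thesis
    using assms
    by (subst laplace_expansion_column[where j = 0]) (auto simp: cofactor_def numeral_2_eq_2)
qed

text \<open>The eigenvectors are (1, 1) and (1, -1), with eigenvalues \<open>a + b\<close> and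
  \<open>a - b\<close>.\<close>

lemma char_poly_sym2:
  fixes a b :: real
  assumes "M \<in> carrier_mat 2 2" "M $$ (0, 0) = a" "M $$ (1, 1) = a" "M $$ (0, 1) = b" "M $$ (1, 0) = b"
  shows "char_poly M = [:-(a + b), 1:] * [:-(a - b), 1:]"
  unfolding char_poly_def using assms
  by (subst det_mat2) (auto simp: char_poly_matrix_def algebra_simps)

lemma proots_mult_linear: "proots ([:-a, 1:] * [:-b, 1:]) = {#a, b#}" for a b :: "'a :: idom"
  by (subst proots_mult) (auto simp: add_mset_commute)

text \<open>The Gram matrix is \<open>(1 - p)^2\<close> times the all-ones matrix plus
  \<open>p^2\<close> times the identity. Its least eigenvalue is thus \<open>p^2\<close>, attained
  at (1, -1), where the dummy row cancels.\<close>

lemma singular_value_erasure: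
  fixes p :: real
  assumes "0 < p" "p \<le> 1"
  shows "singular_value 2 (mat 3 2 (\<lambda>(x, s). if x = 0 then 1 - p else if x = Suc s then p else 0)) = p"
    (is "singular_value 2 ?E = p")
proof -
  define b where "b = (1 - p)\<^sup>2"
  have b: "0 \<le> b"
    by (simp add: b_def)
  define M where "M = transpose_mat ?E * ?E"
  have M: "M $$ (i, j) = (if i = j then b + p\<^sup>2 else b)" if "i < 2" "j < 2" for i j
    using that
    by (auto simp: M_def less_2_cases_iff b_def scalar_prod_def numeral_3_eq_3 power2_eq_square)
  have "M \<in> carrier_mat 2 2"
    by (rule carrier_matI) (simp_all add: M_def)
  then have "char_poly M = [:-((b + p\<^sup>2) + b), 1:] * [:-((b + p\<^sup>2) - b), 1:]"
    by (rule char_poly_sym2) (simp_all add: M)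
  then have "proots (char_poly M) = {#(b + p\<^sup>2) + b, (b + p\<^sup>2) - b#}"
    by (simp only: proots_mult_linear)
  then have "proots (char_poly (transpose_mat ?E * ?E)) = {#2 * b + p\<^sup>2, p\<^sup>2#}"
    by (simp add: M_def[symmetric] algebra_simps)
  moreover have "p \<le> sqrt (2 * b + p\<^sup>2)"
    using b by (intro real_le_rsqrt) simp
  ultimately show ?thesis
    using assms sorted_list_of_multiset_pair[of p "sqrt (2 * b + p\<^sup>2)"]
    by (simp add: singular_value_def singular_values_def)
qed

section \<open>Combination locks\<close>

text \<open>
  State 0 means that all actions so far were correct. Observation 0 is the dummy, observation
  \<open>Suc s\<close> reveals the state \<open>s\<close>. Step \<open>h\<close> asks for the action \<open>\<theta> (h - 1)\<close>.
\<close>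

definition lock_emit :: "real \<Rightarrow> nat \<Rightarrow> nat \<Rightarrow> nat \<Rightarrow> nat pmf" where
  "lock_emit \<alpha> H h s =
     map_pmf (\<lambda>b. if b then Suc s else 0) (bernoulli_pmf (if h = H then 1 else \<alpha>))"

definition lock :: "real \<Rightarrow> nat \<Rightarrow> nat \<Rightarrow> (nat \<Rightarrow> nat) \<Rightarrow> pomdp" where
  "lock \<alpha> H A \<theta> =
     \<lparr>n_states = 2, n_actions = A, n_obs = 3, horizon = H, init = return_pmf 0,
      trans = (\<lambda>h a s. return_pmf (of_bool (\<not> (s = 0 \<and> a = \<theta> (h - 1))))),
      emit = lock_emit \<alpha> H,
      reward = (\<lambda>h x. of_bool (h = H \<and> x = 1))\<rparr>"

lemma lock_simps [simp]:
  "n_states (lock \<alpha> H A \<theta>) = 2" "n_actions (lock \<alpha> H A \<theta>) = A" "n_obs (lock \<alpha> H A \<theta>) = 3"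
  "horizon (lock \<alpha> H A \<theta>) = H" "init (lock \<alpha> H A \<theta>) = return_pmf 0"
  "emit (lock \<alpha> H A \<theta>) = lock_emit \<alpha> H"
  "trans (lock \<alpha> H A \<theta>) h a s = return_pmf (of_bool (\<not> (s = 0 \<and> a = \<theta> (h - 1))))"
  "reward (lock \<alpha> H A \<theta>) h x = of_bool (h = H \<and> x = 1)"
  by (simp_all add: lock_def)

lemma pmf_lock_emit:
  assumes "0 \<le> \<alpha>" "\<alpha> \<le> 1"
  shows "pmf (lock_emit \<alpha> H h s) x =
    (let p = if h = H then 1 else \<alpha> in if x = 0 then 1 - p else if x = Suc s then p else 0)"
  using assms
  by (auto simp: lock_emit_def map_pmf_def pmf_bind Let_def)

lemma lock_emit_last: "lock_emit \<alpha> H H s = return_pmf (Suc s)"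
proof -
  have "bernoulli_pmf 1 = return_pmf True"
    by (rule pmf_eqI) (case_tac i; simp)
  then show ?thesis
    by (simp add: lock_emit_def)
qed

lemma is_pomdp_lock: "is_pomdp (lock \<alpha> H A \<theta>)"
  by (auto simp: is_pomdp_def lock_emit_def)

lemma undercomplete_lock: "undercomplete (lock \<alpha> H A \<theta>)"
  by (simp add: undercomplete_def)

text \<open>The emissions are erasure channels with \<open>p = \<alpha>\<close> before the last step
  and \<open>p = 1\<close> at the last one.\<close>

lemma weakly_revealing_lock:
  assumes "0 < \<alpha>" "\<alpha> \<le> 1" "1 \<le> H"
  shows "weakly_revealing \<alpha> (lock \<alpha> H A \<theta>)"
proof -
  have "emission_matrix (lock \<alpha> H A \<theta>) h =
      mat 3 2 (\<lambda>(x, s). let p = if h = H then 1 else \<alpha> in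
        if x = 0 then 1 - p else if x = Suc s then p else 0)" for h
    using assms by (auto simp: emission_matrix_def pmf_lock_emit)
  then have "\<alpha> \<le> singular_value 2 (emission_matrix (lock \<alpha> H A \<theta>) h)" for h
    using assms singular_value_erasure[of 1] singular_value_erasure[of \<alpha>] by (simp add: Let_def)
  then show ?thesis
    using assms by (auto simp: weakly_revealing_def)
qed

section \<open>Histories\<close>

definition step :: "(history \<Rightarrow> nat pmf) \<Rightarrow> policy \<Rightarrow> history \<Rightarrow> (nat \<times> nat) pmf" where
  "step e \<pi> \<tau> = bind_pmf (e \<tau>) (\<lambda>x. map_pmf (Pair x) (\<pi> (Suc (length \<tau>)) \<tau> x))"

definition plays :: "nat \<Rightarrow> (nat \<Rightarrow> nat) \<Rightarrow> history \<Rightarrow> bool" where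
  "plays n \<theta> \<tau> \<longleftrightarrow> (\<forall>i<n. snd (\<tau> ! i) = \<theta> i)"

text \<open>The hidden state of a lock is a function of the past actions, so the lock can be
  described as a process on histories alone.\<close>

definition lock_obs :: "real \<Rightarrow> nat \<Rightarrow> (nat \<Rightarrow> nat) \<Rightarrow> history \<Rightarrow> nat pmf" where
  "lock_obs \<alpha> H \<theta> \<tau> = lock_emit \<alpha> H (Suc (length \<tau>)) (of_bool (\<not> plays (length \<tau>) \<theta> \<tau>))"

text \<open>Observation 2 reveals state 1, the failure state.\<close>

definition null_obs :: "nat \<Rightarrow> history \<Rightarrow> nat pmf" where
  "null_obs H \<tau> = return_pmf (if Suc (length \<tau>) = H then 2 else 0)"

definition null_episode :: "nat \<Rightarrow> policy \<Rightarrow> history pmf" where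
  "null_episode H \<pi> = chain (step (null_obs H) \<pi>) H"

lemma pmf_step: "pmf (step e \<pi> \<tau>) (x, a) = pmf (e \<tau>) x * pmf (\<pi> (Suc (length \<tau>)) \<tau> x) a"
proof -
  have "pmf (map_pmf (Pair y) (\<pi> (Suc (length \<tau>)) \<tau> y)) (x, a)
      = pmf (\<pi> (Suc (length \<tau>)) \<tau> x) a * indicator {x} y" for y
  proof (cases "y = x")
    case True
    then show ?thesis
      using pmf_map_inj'[of "Pair x" "\<pi> (Suc (length \<tau>)) \<tau> x" a] by (simp add: inj_def)
  next
    case False
    then show ?thesis
      by (auto simp: pmf_eq_0_set_pmf)
  qed
  then show ?thesis
    by (simp add: step_def pmf_bind measure_pmf_single)
qed

lemma plays_snoc:
  "plays (Suc (length \<tau>)) \<theta> (\<tau> @ [y]) \<longleftrightarrow> plays (length \<tau>) \<theta> \<tau> \<and> snd y = \<theta> (length \<tau>)"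
  by (auto simp: plays_def nth_append less_Suc_eq)

lemma plays_take: "n \<le> m \<Longrightarrow> plays n \<theta> (take m \<tau>) \<longleftrightarrow> plays n \<theta> \<tau>"
  by (simp add: plays_def)

text \<open>A history plays just one secret, its own action sequence restricted to
  \<open>{..<n}\<close>. The secrets counted thus lie in an image of \<open>E\<close>.\<close>

lemma card_plays_le:
  assumes "finite E"
  shows "card {\<theta> \<in> {..<n} \<rightarrow>\<^sub>E X. \<exists>\<tau>\<in>E. plays n \<theta> \<tau>} \<le> card E"
proof -
  have "{\<theta> \<in> {..<n} \<rightarrow>\<^sub>E X. \<exists>\<tau>\<in>E. plays n \<theta> \<tau>} \<subseteq> (\<lambda>\<tau>. restrict (\<lambda>i. snd (\<tau> ! i)) {..<n}) ` E"
  proof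
    fix \<theta> assume "\<theta> \<in> {\<theta> \<in> {..<n} \<rightarrow>\<^sub>E X. \<exists>\<tau>\<in>E. plays n \<theta> \<tau>}"
    then obtain \<tau> where \<tau>: "\<theta> \<in> {..<n} \<rightarrow>\<^sub>E X" "\<tau> \<in> E" "plays n \<theta> \<tau>"
      by auto
    then have "\<theta> = restrict (\<lambda>i. snd (\<tau> ! i)) {..<n}"
      by (auto simp: plays_def restrict_def PiE_def extensional_def fun_eq_iff)
    with \<tau> show "\<theta> \<in> (\<lambda>\<tau>. restrict (\<lambda>i. snd (\<tau> ! i)) {..<n}) ` E"
      by blast
  qed
  then show ?thesis
    using assms by (meson card_image_le card_mono finite_imageI order_trans)
qed

text \<open>Eliminates the state: the transitions are deterministic, so it can be recomputed from
  the history.\<close>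

lemma trajectory_lock:
  "trajectory (lock \<alpha> H A \<theta>) \<pi> h =
     map_pmf (\<lambda>\<tau>. (\<tau>, of_bool (\<not> plays h \<theta> \<tau>))) (chain (step (lock_obs \<alpha> H \<theta>) \<pi>) h)"
proof (induction h)
  case 0
  then show ?case
    by (simp add: plays_def)
next
  case (Suc h)
  have "trajectory (lock \<alpha> H A \<theta>) \<pi> (Suc h) =
      bind_pmf (chain (step (lock_obs \<alpha> H \<theta>) \<pi>) h) (\<lambda>\<tau>.
        bind_pmf (lock_emit \<alpha> H (Suc h) (of_bool (\<not> plays h \<theta> \<tau>))) (\<lambda>x.
        map_pmf (\<lambda>a. (\<tau> @ [(x, a)], of_bool (\<not> (plays h \<theta> \<tau> \<and> a = \<theta> h)))) (\<pi> (Suc h) \<tau> x)))"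
    by (simp add: Suc.IH map_pmf_def bind_assoc_pmf bind_return_pmf del: of_bool_or_iff)
  also have "\<dots> = map_pmf (\<lambda>\<tau>. (\<tau>, of_bool (\<not> plays (Suc h) \<theta> \<tau>)))
      (chain (step (lock_obs \<alpha> H \<theta>) \<pi>) (Suc h))"
    unfolding chain.simps map_bind_pmf
  proof (rule bind_pmf_cong[OF refl])
    fix \<tau> assume "\<tau> \<in> set_pmf (chain (step (lock_obs \<alpha> H \<theta>) \<pi>) h)"
    then have h: "h = length \<tau>"
      by (simp add: length_chain)
    show "bind_pmf (lock_emit \<alpha> H (Suc h) (of_bool (\<not> plays h \<theta> \<tau>))) (\<lambda>x.
        map_pmf (\<lambda>a. (\<tau> @ [(x, a)], of_bool (\<not> (plays h \<theta> \<tau> \<and> a = \<theta> h)))) (\<pi> (Suc h) \<tau> x))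
      = map_pmf (\<lambda>\<tau>. (\<tau>, of_bool (\<not> plays (Suc h) \<theta> \<tau>)))
          (map_pmf (\<lambda>x. \<tau> @ [x]) (step (lock_obs \<alpha> H \<theta>) \<pi> \<tau>))"
      by (simp add: h step_def lock_obs_def map_bind_pmf pmf.map_comp o_def plays_snoc)
  qed
  finally show ?case .
qed

lemma episode_lock: "episode (lock \<alpha> H A \<theta>) \<pi> = chain (step (lock_obs \<alpha> H \<theta>) \<pi>) H"
  by (simp add: episode_def trajectory_lock pmf.map_comp o_def)

text \<open>
  The factor \<open>1 - \<alpha>\<close> is lost at each step but the last, where a lock whose secret was missed shows
  the same observation as the null process.
\<close>

lemma pmf_episode_ge:
  assumes "0 < \<alpha>" "\<alpha> \<le> 1" "1 \<le> H" and "length \<tau> = H" "\<not> plays (H - 1) \<theta> \<tau>"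
  shows "(1 - \<alpha>) ^ (H - 1) * pmf (null_episode H \<pi>) \<tau> \<le> pmf (episode (lock \<alpha> H A \<theta>) \<pi>) \<tau>"
proof -
  define c where "c i = (if Suc i = H then 1 else 1 - \<alpha>)" for i
  have obs: "c i * pmf (null_obs H (take i \<tau>)) x \<le> pmf (lock_obs \<alpha> H \<theta> (take i \<tau>)) x"
    if "i < H" for i x
  proof (cases "Suc i = H")
    case True
    then have "\<not> plays i \<theta> (take i \<tau>)"
      using assms by (auto simp: plays_take)
    then show ?thesis
      using True assms by (auto simp: c_def null_obs_def lock_obs_def pmf_lock_emit)
  next
    case False
    then show ?thesis
      using that assms by (auto simp: c_def null_obs_def lock_obs_def pmf_lock_emit Let_def indicator_def)
  qed
  have "(\<Prod>i<H. c i) * pmf (null_episode H \<pi>) \<tau> \<le> pmf (episode (lock \<alpha> H A \<theta>) \<pi>) \<tau>"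
    unfolding null_episode_def episode_lock
  proof (rule pmf_chain_mono)
    fix i assume "i < H"
    \<comment> \<open>The policy contributes the same factor under both laws, so comparing the
      observation laws suffices.\<close>
    show "c i * pmf (step (null_obs H) \<pi> (take i \<tau>)) (\<tau> ! i)
        \<le> pmf (step (lock_obs \<alpha> H \<theta>) \<pi> (take i \<tau>)) (\<tau> ! i)"
      using mult_right_mono[OF obs[OF \<open>i < H\<close>, of "fst (\<tau> ! i)"], of "pmf (\<pi> _ _ _) _"]
      by (cases "\<tau> ! i") (simp add: pmf_step mult.assoc)
  qed (use assms in \<open>auto simp: c_def\<close>)
  moreover have "(\<Prod>i<H. c i) = (1 - \<alpha>) ^ (H - 1)"
  proof -
    obtain n where "H = Suc n"
      using assms(3) by (cases H) auto
    then show ?thesis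
      by (simp add: c_def)
  qed
  ultimately show ?thesis
    by simp
qed

section \<open>Values\<close>

text \<open>The only reward is paid for observation 1 at step \<open>H\<close>, so the return of an
  episode is an indicator.\<close>

lemma policy_value_lock:
  assumes "1 \<le> H"
  shows "policy_value (lock \<alpha> H A \<theta>) \<pi> =
    measure_pmf.prob (episode (lock \<alpha> H A \<theta>) \<pi>) {\<tau>. fst (\<tau> ! (H - 1)) = 1}"
proof -
  have "(\<Sum>h=1..H. of_bool (h = H \<and> fst (\<tau> ! (h - 1)) = 1)) =
      (indicator {\<tau>. fst (\<tau> ! (H - 1)) = 1} \<tau> :: real)" for \<tau> :: history
  proof -
    have "(\<Sum>h=1..H. of_bool (h = H \<and> fst (\<tau> ! (h - 1)) = 1)) =
        (\<Sum>h=1..H. if h = H then of_bool (fst (\<tau> ! (H - 1)) = 1) else (0 :: real))"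
      by (intro sum.cong) auto
    then show ?thesis
      using assms by (simp add: indicator_def)
  qed
  then show ?thesis
    by (simp add: policy_value_def)
qed

lemma optimal_value_lock:
  assumes "1 \<le> H" "1 \<le> A" and \<theta>: "\<theta> \<in> {..<H - 1} \<rightarrow>\<^sub>E {..<A}"
  shows "1 \<le> optimal_value (lock \<alpha> H A \<theta>)"
proof -
  \<comment> \<open>This policy plays the secret. An extensional \<open>\<theta>\<close> is
    \<open>undefined\<close> at \<open>H - 1\<close>, so the last action is set to 0, which is legal
    because \<open>1 \<le> A\<close>.\<close>
  define \<pi> :: policy where "\<pi> h \<tau> x = return_pmf (if h < H then \<theta> (h - 1) else 0)" for h \<tau> x
  have \<pi>: "is_policy 3 A H \<pi>"
    using assms by (auto simp: is_policy_def valid_history_def \<pi>_def PiE_def Pi_def)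
  have "fst (\<tau> ! (H - 1)) = 1" if "\<tau> \<in> set_pmf (episode (lock \<alpha> H A \<theta>) \<pi>)" for \<tau>
  proof -
    have \<tau>: "\<tau> ! i \<in> set_pmf (step (lock_obs \<alpha> H \<theta>) \<pi> (take i \<tau>))" "length \<tau> = H" if "i < H" for i
      using that \<open>\<tau> \<in> _\<close> by (auto simp: episode_lock nth_chain length_chain)
    have "snd (\<tau> ! i) = \<theta> i" if "i < H - 1" for i
    proof -
      have "i < H" "Suc i < H"
        using that by auto
      then show ?thesis
        using \<tau>(1)[of i] \<tau>(2)[of i] by (auto simp: step_def \<pi>_def)
    qed
    then have "plays (H - 1) \<theta> \<tau>"
      by (simp add: plays_def)
    then show ?thesis
      using \<tau>[of "H - 1"] assms(1)
      by (auto simp: step_def lock_obs_def lock_emit_last plays_take)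
  qed
  then have "measure_pmf.prob (episode (lock \<alpha> H A \<theta>) \<pi>) {\<tau>. fst (\<tau> ! (H - 1)) = 1} = 1"
    by (subst measure_pmf.prob_eq_1) (auto simp: AE_measure_pmf_iff)
  then have "policy_value (lock \<alpha> H A \<theta>) \<pi> = 1"
    using assms by (simp add: policy_value_lock)
  \<comment> \<open>A supremum of reals bounds its members only if the set is bounded above; here
    the values are probabilities, so 1 is a bound.\<close>
  moreover have "policy_value (lock \<alpha> H A \<theta>) \<pi> \<le> optimal_value (lock \<alpha> H A \<theta>)"
    unfolding optimal_value_def using assms \<pi>
    by (intro cSUP_upper bdd_aboveI2[where M = 1]) (auto simp: policy_value_lock)
  ultimately show ?thesis
    by simp
qed

text \<open>The null process never earns the reward, its last observation being 2. What remains of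
  the change of measure is the Bernoulli loss and the null probability of playing the
  secret.\<close>

lemma policy_value_lock_le:
  assumes "0 < \<alpha>" "\<alpha> \<le> 1" "1 \<le> H"
  shows "policy_value (lock \<alpha> H A \<theta>) \<pi> \<le>
    \<alpha> * real H + measure_pmf.prob (null_episode H \<pi>) {\<tau>. plays (H - 1) \<theta> \<tau>}"
proof -
  define q where "q = null_episode H \<pi>"
  \<comment> \<open>Fixing the length makes the episode comparison applicable and does not change
    the null mass, as \<open>q\<close> lives on lists of length \<open>H\<close>.\<close>
  define G where "G = {\<tau>. length \<tau> = H \<and> \<not> plays (H - 1) \<theta> \<tau>}"
  define F :: "history set" where "F = {\<tau>. fst (\<tau> ! (H - 1)) = 1}"
  have q: "length \<tau> = H" "fst (\<tau> ! (H - 1)) = 2" if "\<tau> \<in> set_pmf q" for \<tau>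
    using that assms(3) nth_chain[of \<tau> "step (null_obs H) \<pi>" H "H - 1"]
    by (auto simp: q_def null_episode_def step_def null_obs_def length_chain)
  have "policy_value (lock \<alpha> H A \<theta>) \<pi> \<le>
      measure_pmf.prob q F + (1 - (1 - \<alpha>) ^ (H - 1)) + measure_pmf.prob q (- G)"
    unfolding policy_value_lock[OF assms(3)] F_def
  proof (rule prob_le_of_pmf_ge)
    show "(1 - \<alpha>) ^ (H - 1) * pmf q \<tau> \<le> pmf (episode (lock \<alpha> H A \<theta>) \<pi>) \<tau>" if "\<tau> \<in> G" for \<tau>
      unfolding q_def by (rule pmf_episode_ge) (use that assms in \<open>simp_all add: G_def\<close>)
  qed (use assms in \<open>auto intro: power_le_one\<close>)
  moreover have "measure_pmf.prob q F = 0"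
    using q by (force simp: measure_pmf_zero_iff F_def)
  moreover have "measure_pmf.prob q (- G) = measure_pmf.prob q {\<tau>. plays (H - 1) \<theta> \<tau>}"
    using q by (intro measure_prob_cong_0) (auto simp: G_def set_pmf_iff)
  moreover have "1 - real (H - 1) * \<alpha> \<le> (1 - \<alpha>) ^ (H - 1)"
    using Bernoulli_inequality[of "- \<alpha>" "H - 1"] assms by simp
  moreover have "real (H - 1) * \<alpha> \<le> \<alpha> * real H"
    using assms by (simp add: mult.commute mult_left_mono)
  ultimately show ?thesis
    by (simp add: q_def)
qed

text \<open>A (1/2)-optimal policy has value at least 1/2, of which \<open>\<alpha> * real H\<close>
  explains at most 1/4. So the null process plays each such secret with probability at least 1/4,
  and these probabilities add up to at most 1.\<close>

lemma card_eps_optimal_lock_le: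
  assumes "0 < \<alpha>" "\<alpha> \<le> 1" "1 \<le> H" "1 \<le> A" "\<alpha> * real H \<le> 1/4"
  shows "card {\<theta> \<in> {..<H - 1} \<rightarrow>\<^sub>E {..<A}. eps_optimal (lock \<alpha> H A \<theta>) (1/2) \<pi>} \<le> 4"
proof -
  define T where "T = {..<H - 1} \<rightarrow>\<^sub>E {..<A}"
  define T' where "T' = {\<theta> \<in> T. eps_optimal (lock \<alpha> H A \<theta>) (1/2) \<pi>}"
  define q where "q = null_episode H \<pi>"
  have T: "finite T"
    by (simp add: T_def finite_PiE)
  have "1/4 \<le> measure_pmf.prob q {\<tau>. plays (H - 1) \<theta> \<tau>}" if "\<theta> \<in> T'" for \<theta>
    using that policy_value_lock_le[of \<alpha> H A \<theta> \<pi>] optimal_value_lock[of H A \<theta> \<alpha>] assms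
    by (auto simp: T'_def T_def eps_optimal_def q_def)
  then have "(\<Sum>\<theta>\<in>T'. 1/4) \<le> (\<Sum>\<theta>\<in>T'. measure_pmf.prob q {\<tau>. plays (H - 1) \<theta> \<tau>})"
    by (rule sum_mono)
  also have "\<dots> \<le> (\<Sum>\<theta>\<in>T. measure_pmf.prob q {\<tau>. plays (H - 1) \<theta> \<tau>})"
    using T by (intro sum_mono2) (auto simp: T'_def)
  also have "\<dots> \<le> real 1"
    using card_plays_le[of "{_}"] T by (intro sum_prob_le_card) (auto simp: T_def)
  finally show ?thesis
    by (simp add: T'_def T_def)
qed

section \<open>Learning\<close>

text \<open>All locks share one reward function, so the data shown to the learner depend on the
  history but not on the secret.\<close>

definition record_of :: "nat \<Rightarrow> history \<Rightarrow> episode_data" where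
  "record_of H \<tau> = map (\<lambda>(h, x, a). (x, a, of_bool (h = H \<and> x = 1))) (List.enumerate 1 \<tau>)"

lemma observed_lock: "observed (lock \<alpha> H A \<theta>) = record_of H"
  by (simp add: observed_def record_of_def fun_eq_iff)

text \<open>The episode law \<open>ep\<close> is a parameter so that the learner can also be run
  against the null process, which is given only as a law of histories.\<close>

definition runs :: "nat \<Rightarrow> learner \<Rightarrow> real \<Rightarrow> (policy \<Rightarrow> history pmf) \<Rightarrow> nat \<Rightarrow> history list pmf" where
  "runs H L \<omega> ep = chain (\<lambda>E. ep (explore L \<omega> (map (record_of H) E)))"

lemma interaction_lock:
  "interaction (lock \<alpha> H A \<theta>) L \<omega> K =
     map_pmf (map (record_of H)) (runs H L \<omega> (episode (lock \<alpha> H A \<theta>)) K)"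
  by (induction K)
     (simp_all add: runs_def observed_lock bind_map_pmf map_bind_pmf pmf.map_comp o_def)

text \<open>The comparison of single episodes is chained over \<open>K\<close> episodes. The ratio
  becomes \<open>(1 - \<alpha>) ^ ((H - 1) * K)\<close>, and Bernoulli's inequality makes the loss
  linear in \<open>K\<close>.\<close>

lemma prob_runs_le:
  fixes F :: "history list set"
  assumes "0 < \<alpha>" "\<alpha> \<le> 1" "1 \<le> H"
  shows "measure_pmf.prob (runs H L \<omega> (episode (lock \<alpha> H A \<theta>)) K) F \<le>
    measure_pmf.prob (runs H L \<omega> (null_episode H) K) F + \<alpha> * real H * real K +
    measure_pmf.prob (runs H L \<omega> (null_episode H) K) {E. \<exists>\<tau>\<in>set E. plays (H - 1) \<theta> \<tau>}"
proof -
  define q where "q = runs H L \<omega> (null_episode H) K"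
  define G where "G = {E. length E = K \<and> (\<forall>\<tau>\<in>set E. length \<tau> = H \<and> \<not> plays (H - 1) \<theta> \<tau>)}"
  define c where "c = (1 - \<alpha>) ^ (H - 1)"
  have c: "0 \<le> c" "c \<le> 1"
    using assms by (auto simp: c_def power_le_one)
  have q: "length E = K \<and> (\<forall>\<tau>\<in>set E. length \<tau> = H)" if "E \<in> set_pmf q" for E
  proof -
    have E: "length E = K"
      using that by (simp add: q_def runs_def length_chain)
    have "length (E ! i) = H" if "i < K" for i
      using nth_chain[OF \<open>E \<in> set_pmf q\<close>[unfolded q_def runs_def] that]
      by (simp add: null_episode_def length_chain)
    with E show ?thesis
      by (auto simp: in_set_conv_nth)
  qed
  have "c ^ K * pmf q E \<le> pmf (runs H L \<omega> (episode (lock \<alpha> H A \<theta>)) K) E" if "E \<in> G" for E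
  proof -
    have "(\<Prod>i<K. c) * pmf q E \<le> pmf (runs H L \<omega> (episode (lock \<alpha> H A \<theta>)) K) E"
      unfolding q_def runs_def
    proof (rule pmf_chain_mono)
      fix i assume "i < K"
      then have "length (E ! i) = H" "\<not> plays (H - 1) \<theta> (E ! i)"
        using that by (auto simp: G_def)
      then show "c * pmf (null_episode H (explore L \<omega> (map (record_of H) (take i E)))) (E ! i)
          \<le> pmf (episode (lock \<alpha> H A \<theta>) (explore L \<omega> (map (record_of H) (take i E)))) (E ! i)"
        unfolding c_def by (rule pmf_episode_ge[OF assms])
    qed (use that c in \<open>auto simp: G_def\<close>)
    then show ?thesis
      by simp
  qed
  then have "measure_pmf.prob (runs H L \<omega> (episode (lock \<alpha> H A \<theta>)) K) F \<le>
      measure_pmf.prob q F + (1 - c ^ K) + measure_pmf.prob q (- G)"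
    using c by (intro prob_le_of_pmf_ge) (auto simp: power_le_one)
  moreover have "measure_pmf.prob q (- G) = measure_pmf.prob q {E. \<exists>\<tau>\<in>set E. plays (H - 1) \<theta> \<tau>}"
    using q by (intro measure_prob_cong_0) (auto simp: G_def set_pmf_iff)
  moreover have "1 - \<alpha> * real H * real K \<le> c ^ K"
  proof -
    have "1 - real ((H - 1) * K) * \<alpha> \<le> (1 - \<alpha>) ^ ((H - 1) * K)"
      using Bernoulli_inequality[of "- \<alpha>" "(H - 1) * K"] assms by simp
    moreover have "real ((H - 1) * K) * \<alpha> \<le> real (H * K) * \<alpha>"
      using assms by (intro mult_right_mono of_nat_mono mult_le_mono1) auto
    moreover have "c ^ K = (1 - \<alpha>) ^ ((H - 1) * K)"
      by (simp add: c_def power_mult)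
    ultimately show ?thesis
      by (simp add: mult_ac)
  qed
  ultimately show ?thesis
    by (simp add: q_def)
qed

text \<open>For a fixed seed, under the null law the final policy is good for at most 4 secrets and
  the \<open>K\<close> episodes play at most \<open>K\<close> of them. The middle term is the change
  of measure, paid once per secret.\<close>

lemma sum_success_le:
  assumes "0 < \<alpha>" "\<alpha> \<le> 1" "1 \<le> H" "1 \<le> A" "\<alpha> * real H \<le> 1/4"
  shows "(\<Sum>\<theta>\<in>{..<H - 1} \<rightarrow>\<^sub>E {..<A}. measure_pmf.prob (interaction (lock \<alpha> H A \<theta>) L \<omega> K)
      {D. eps_optimal (lock \<alpha> H A \<theta>) (1/2) (final_policy L \<omega> D)})
    \<le> 4 + real A ^ (H - 1) * (\<alpha> * real H * real K) + real K"
proof -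
  define T where "T = {..<H - 1} \<rightarrow>\<^sub>E {..<A}"
  define q where "q = runs H L \<omega> (null_episode H) K"
  define good where "good \<theta> E \<longleftrightarrow>
    eps_optimal (lock \<alpha> H A \<theta>) (1/2) (final_policy L \<omega> (map (record_of H) E))" for \<theta> E
  have T: "finite T" "real (card T) = real A ^ (H - 1)"
    by (simp_all add: T_def finite_PiE card_PiE)
  have "(\<Sum>\<theta>\<in>T. measure_pmf.prob (interaction (lock \<alpha> H A \<theta>) L \<omega> K)
      {D. eps_optimal (lock \<alpha> H A \<theta>) (1/2) (final_policy L \<omega> D)})
    = (\<Sum>\<theta>\<in>T. measure_pmf.prob (runs H L \<omega> (episode (lock \<alpha> H A \<theta>)) K) {E. good \<theta> E})"
    by (simp add: interaction_lock good_def vimage_def)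
  also have "\<dots> \<le> (\<Sum>\<theta>\<in>T. measure_pmf.prob q {E. good \<theta> E} + \<alpha> * real H * real K +
      measure_pmf.prob q {E. \<exists>\<tau>\<in>set E. plays (H - 1) \<theta> \<tau>})"
    unfolding q_def using assms by (intro sum_mono prob_runs_le)
  also have "\<dots> = (\<Sum>\<theta>\<in>T. measure_pmf.prob q {E. good \<theta> E}) + real (card T) * (\<alpha> * real H * real K) +
      (\<Sum>\<theta>\<in>T. measure_pmf.prob q {E. \<exists>\<tau>\<in>set E. plays (H - 1) \<theta> \<tau>})"
    by (simp add: sum.distrib)
  also have "\<dots> \<le> real 4 + real (card T) * (\<alpha> * real H * real K) + real K"
  proof (intro add_mono order.refl)
    show "(\<Sum>\<theta>\<in>T. measure_pmf.prob q {E. good \<theta> E}) \<le> real 4"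
      using T card_eps_optimal_lock_le[OF assms]
      by (intro sum_prob_le_card) (auto simp: T_def good_def)
    have "card {\<theta> \<in> T. \<exists>\<tau>\<in>set E. plays (H - 1) \<theta> \<tau>} \<le> K" if "E \<in> set_pmf q" for E
      using card_plays_le[of "set E" "H - 1" "{..<A}"] card_length[of E] that
      by (auto simp: T_def q_def runs_def length_chain)
    then show "(\<Sum>\<theta>\<in>T. measure_pmf.prob q {E. \<exists>\<tau>\<in>set E. plays (H - 1) \<theta> \<tau>}) \<le> real K"
      using T by (intro sum_prob_le_card)
  qed
  finally show ?thesis
    using T by (simp add: T_def)
qed

text \<open>Averages a bound for every fixed seed over the seed. Positive success probabilities
  supply the integrability needed to exchange sum and integral.\<close>

lemma sum_success_prob_le:
  assumes "prob_space (seed L)" and "\<And>M. M \<in> X \<Longrightarrow> 0 < success_prob (m M) L K \<epsilon>"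
    and "\<And>\<omega>. (\<Sum>M\<in>X. measure_pmf.prob (interaction (m M) L \<omega> K)
      {D. eps_optimal (m M) \<epsilon> (final_policy L \<omega> D)}) \<le> B"
  shows "(\<Sum>M\<in>X. success_prob (m M) L K \<epsilon>) \<le> B"
proof -
  interpret prob_space "seed L" by fact
  let ?f = "\<lambda>M \<omega>. measure_pmf.prob (interaction (m M) L \<omega> K)
    {D. eps_optimal (m M) \<epsilon> (final_policy L \<omega> D)}"
  \<comment> \<open>a function that is not integrable has integral 0\<close>
  have int: "integrable (seed L) (?f M)" if "M \<in> X" for M
    using assms(2)[OF that] not_integrable_integral_eq[of "seed L" "?f M"]
    by (auto simp: success_prob_def)
  have "(\<Sum>M\<in>X. success_prob (m M) L K \<epsilon>) = (\<integral>\<omega>. (\<Sum>M\<in>X. ?f M \<omega>) \<partial>seed L)"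
    using int by (simp add: success_prob_def)
  also have "\<dots> \<le> B"
    using int assms(3) by (intro integral_le_const) auto
  finally show ?thesis .
qed

text \<open>Hardness is stated for a family of instances with common parameters: for a single POMDP,
  a learner could ignore its data and output a near-optimal policy. With too few samples, each
  learner fails on some member.\<close>

theorem theorem6:
  shows "\<exists>(c::real) > 0. \<exists>C::nat. \<forall>(\<alpha>::real) (H::nat) (A::nat).
    0 < \<alpha> \<and> \<alpha> < 1/2 \<and> H \<ge> 1 \<and> A \<ge> 1 \<longrightarrow>
    (\<exists>(nS::nat) (nO::nat) (\<M>::pomdp set).
       nS \<le> C \<and> nO \<le> C \<and> \<M> \<noteq> {} \<and>
       (\<forall>M\<in>\<M>. is_pomdp M \<and> n_states M = nS \<and> n_obs M = nO \<and> n_actions M = A \<and> horizon M = H \<and>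
          undercomplete M \<and> weakly_revealing \<alpha> M) \<and>
       (\<forall>(L::learner) (K::nat).
          is_learner nO A H L \<and> K \<ge> 1 \<and> (\<forall>M\<in>\<M>. success_prob M L K (1/2) \<ge> 1/6) \<longrightarrow>
          real K \<ge> c * min (1 / (\<alpha> * real H)) (real A ^ (H - 1))))"
proof -
  have main: "1/36 * min (1 / (\<alpha> * real H)) (real A ^ (H - 1)) \<le> real K"
    if \<alpha>: "0 < \<alpha>" "\<alpha> < 1/2" and HA: "1 \<le> H" "1 \<le> A" and K: "1 \<le> K" and L: "is_learner 3 A H L"
      and succ: "\<And>\<theta>. \<theta> \<in> {..<H - 1} \<rightarrow>\<^sub>E {..<A} \<Longrightarrow> 1/6 \<le> success_prob (lock \<alpha> H A \<theta>) L K (1/2)"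
    for \<alpha> :: real and H A K :: nat and L
  proof (cases "\<alpha> * real H \<le> 1/4")
    case False
    \<comment> \<open>In this case the quotient is even below 4, so the claim follows from
      \<open>1 \<le> K\<close>.\<close>
    then have "1 / (\<alpha> * real H) \<le> 36"
      by (simp add: field_simps)
    then have "min (1 / (\<alpha> * real H)) (real A ^ (H - 1)) \<le> 36"
      by (rule min.coboundedI1)
    then show ?thesis
      using K by simp
  next
    case True
    define N where "N = real A ^ (H - 1)"
    define m where "m = min (1 / (\<alpha> * real H)) N"
    have N: "0 < N"
      using HA by (simp add: N_def)
    have m: "0 < m" "m \<le> N" "m * (\<alpha> * real H) \<le> 1"
      using \<alpha> HA N by (auto simp: m_def min_def field_simps)
    have "N * (1/6) = (\<Sum>\<theta>\<in>{..<H - 1} \<rightarrow>\<^sub>E {..<A}. 1/6)"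
      by (simp add: N_def card_PiE)
    also have "\<dots> \<le> (\<Sum>\<theta>\<in>{..<H - 1} \<rightarrow>\<^sub>E {..<A}. success_prob (lock \<alpha> H A \<theta>) L K (1/2))"
      by (intro sum_mono succ)
    also have "\<dots> \<le> 4 + N * (\<alpha> * real H * real K) + real K"
    proof (rule sum_success_prob_le)
      show "prob_space (seed L)"
        using L by (simp add: is_learner_def)
      show "0 < success_prob (lock \<alpha> H A \<theta>) L K (1/2)" if "\<theta> \<in> {..<H - 1} \<rightarrow>\<^sub>E {..<A}" for \<theta>
        using succ[OF that] by simp
      show "(\<Sum>\<theta>\<in>{..<H - 1} \<rightarrow>\<^sub>E {..<A}. measure_pmf.prob (interaction (lock \<alpha> H A \<theta>) L \<omega> K)
          {D. eps_optimal (lock \<alpha> H A \<theta>) (1/2) (final_policy L \<omega> D)})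
        \<le> 4 + N * (\<alpha> * real H * real K) + real K" for \<omega>
        unfolding N_def by (rule sum_success_le) (use \<alpha> HA True in auto)
    qed
    \<comment> \<open>The constant 4 is absorbed by \<open>1 \<le> K\<close>.\<close>
    also have "\<dots> \<le> N * (\<alpha> * real H * real K) + 5 * real K"
      using K by simp
    \<comment> \<open>After multiplying by \<open>m\<close>, the bounds
      \<open>m * (\<alpha> * real H) \<le> 1\<close> and \<open>m \<le> N\<close> turn the right
      side into \<open>6 * N * K\<close>. With the 1/6 on the left this gives the constant
      36.\<close>
    finally have "m * (N * (1/6)) \<le> m * (N * (\<alpha> * real H * real K) + 5 * real K)"
      using m by (intro mult_left_mono) auto
    also have "\<dots> = N * (m * (\<alpha> * real H)) * real K + m * (5 * real K)"
      by (simp add: algebra_simps)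
    also have "\<dots> \<le> N * 1 * real K + N * (5 * real K)"
      using m N by (intro add_mono mult_mono mult_left_mono) (auto simp: \<alpha> less_imp_le)
    finally have "N * m \<le> N * (36 * real K)"
      by (simp add: algebra_simps)
    then show ?thesis
      using N by (simp add: m_def N_def)
  qed
  have family: "\<exists>nS nO (\<M>::pomdp set).
       nS \<le> 3 \<and> nO \<le> (3::nat) \<and> \<M> \<noteq> {} \<and>
       (\<forall>M\<in>\<M>. is_pomdp M \<and> n_states M = nS \<and> n_obs M = nO \<and> n_actions M = A \<and> horizon M = H \<and>
          undercomplete M \<and> weakly_revealing \<alpha> M) \<and>
       (\<forall>(L::learner) (K::nat).
          is_learner nO A H L \<and> K \<ge> 1 \<and> (\<forall>M\<in>\<M>. success_prob M L K (1/2) \<ge> 1/6) \<longrightarrow>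
          real K \<ge> 1/36 * min (1 / (\<alpha> * real H)) (real A ^ (H - 1)))"
    if "0 < \<alpha>" "\<alpha> < 1/2" "1 \<le> H" "1 \<le> A" for \<alpha> :: real and H A :: nat
  \<comment> \<open>The witnesses stay schematic until the facts below fix them: all locks with
    secrets in \<open>?T\<close>, 2 states and 3 observations.\<close>
  proof (intro exI conjI)
    let ?T = "{..<H - 1} \<rightarrow>\<^sub>E {..<A}"
    show "lock \<alpha> H A ` ?T \<noteq> {}"
      using that by (auto simp: PiE_eq_empty_iff lessThan_empty_iff)
    show "\<forall>M\<in>lock \<alpha> H A ` ?T. is_pomdp M \<and> n_states M = 2 \<and> n_obs M = 3 \<and> n_actions M = A \<and>
        horizon M = H \<and> undercomplete M \<and> weakly_revealing \<alpha> M"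
      using that by (auto simp: is_pomdp_lock undercomplete_lock weakly_revealing_lock)
    show "\<forall>L K. is_learner 3 A H L \<and> K \<ge> 1 \<and> (\<forall>M\<in>lock \<alpha> H A ` ?T. success_prob M L K (1/2) \<ge> 1/6) \<longrightarrow>
        real K \<ge> 1/36 * min (1 / (\<alpha> * real H)) (real A ^ (H - 1))"
      using main that by auto
  qed simp_all
  show ?thesis
    by (rule exI[of _ "1/36"], rule conjI, simp, rule exI[of _ 3], intro allI impI, elim conjE)
       (rule family; assumption)
qed

end
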